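(* The bad triangle transversal problem (BTT) on signed graphs is as hard to approximate as minimum vertex cover: for every $\alpha\ge1$, if there is a polynomial-time $\alpha$-approximation algorithm for BTT on signed graphs, then there is a polynomial-time $\alpha$-approximation algorithm for minimum vertex cover on (unsigned) graphs.
   Context: A signed graph is $G=(V,E^+,E^-)$ with disjoint sets $E^+$ (positive edges) and $E^-$ (negative edges) of unordered vertex pairs; $E=E^+\cup E^-$. A bad triangle is a set of three vertices pairwise joined by edges of $E$ with exactly one of the three edges negative. BTT asks, given a signed graph, for a minimum-size set $C\subseteq E$ containing at least one edge of every bad triangle. *)

theory Defs
  imports Complex_Main "HOL-Computational_Algebra.Polynomial"
begin

section \<open>Deterministic multi-tape Turing machines\<close>

text \<open>
  A tape is infinite in both directions and is indexed relative to the head: the head always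
  scans cell 0, and a move shifts the contents. Symbol 0 is the blank.
\<close>

type_synonym tape = "int \<Rightarrow> nat"

datatype move = MLeft | MStay | MRight

fun offset :: "move \<Rightarrow> int" where
  "offset MLeft = -1"
| "offset MStay = 0"
| "offset MRight = 1"

definition act :: "nat \<times> move \<Rightarrow> tape \<Rightarrow> tape" where
  "act a t = (\<lambda>i. (t(0 := fst a)) (i + offset (snd a)))"

text \<open>
  The non-halting states are \<open>0, \<dots>, num_states M - 1\<close>, with 0 initial; the only halting
  state is \<open>num_states M\<close>. The tape alphabet is \<open>{..<num_symbols M}\<close>.
\<close>

record tm =
  num_tapes :: nat
  num_states :: nat
  num_symbols :: nat
  trans :: "nat \<Rightarrow> nat list \<Rightarrow> nat \<times> (nat \<times> move) list"

definition tm_wf :: "tm \<Rightarrow> bool" where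
  "tm_wf M \<longleftrightarrow>
     num_tapes M \<ge> 1 \<and> num_symbols M \<ge> 1 \<and>
     (\<forall>q xs. q < num_states M \<and> length xs = num_tapes M \<and> set xs \<subseteq> {..<num_symbols M} \<longrightarrow>
        fst (trans M q xs) \<le> num_states M \<and>
        length (snd (trans M q xs)) = num_tapes M \<and>
        fst ` set (snd (trans M q xs)) \<subseteq> {..<num_symbols M})"

type_synonym config = "nat \<times> tape list"

definition tm_step :: "tm \<Rightarrow> config \<Rightarrow> config" where
  "tm_step M c =
     (let (q, ts) = c in
      if q < num_states M
      then let (q', as) = trans M q (map (\<lambda>t. t 0) ts) in (q', map2 act as ts)
      else c)"

definition input_tape :: "nat list \<Rightarrow> tape" where
  "input_tape w = (\<lambda>i. if 0 \<le> i \<and> i < int (length w) then w ! nat i else 0)"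

definition blank_tape :: tape where
  "blank_tape = (\<lambda>i. 0)"

definition init_config :: "tm \<Rightarrow> nat list \<Rightarrow> config" where
  "init_config M w = (0, input_tape w # replicate (num_tapes M - 1) blank_tape)"

text \<open>The output is the blank-free word that starts at the head and ends before the next blank.\<close>

definition reads :: "tape \<Rightarrow> nat list \<Rightarrow> bool" where
  "reads t w \<longleftrightarrow>
     0 \<notin> set w \<and> (\<forall>i<length w. t (int i) = w ! i) \<and> t (int (length w)) = 0"

text \<open>Input and output are both on the first tape. The halting state is never left, so the
  machine has halted after at most \<open>n\<close> steps.\<close>

definition computes_within :: "tm \<Rightarrow> nat list \<Rightarrow> nat \<Rightarrow> nat list \<Rightarrow> bool" where
  "computes_within M w n v \<longleftrightarrow>
     (\<exists>ts. (tm_step M ^^ n) (init_config M w) = (num_states M, ts) \<and> reads (hd ts) v)"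


section \<open>Minimization problems and approximation algorithms\<close>

record ('i, 's) min_problem =
  is_instance :: "'i \<Rightarrow> bool"
  feasible :: "'i \<Rightarrow> 's \<Rightarrow> bool"
  cost :: "'i \<Rightarrow> 's \<Rightarrow> nat"
  enc_instance :: "'i \<Rightarrow> nat list"
  enc_solution :: "'i \<Rightarrow> 's \<Rightarrow> nat list"

definition opt :: "('i, 's) min_problem \<Rightarrow> 'i \<Rightarrow> nat" where
  "opt P x = (LEAST c. \<exists>s. feasible P x s \<and> cost P x s = c)"

definition poly_time_approx_alg :: "real \<Rightarrow> ('i, 's) min_problem \<Rightarrow> tm \<Rightarrow> bool" where
  "poly_time_approx_alg \<alpha> P M \<longleftrightarrow>
     tm_wf M \<and>
     (\<exists>p :: nat poly. \<forall>x. is_instance P x \<longrightarrow>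
        set (enc_instance P x) \<subseteq> {..<num_symbols M} \<and>
        (\<exists>s. feasible P x s \<and>
             real (cost P x s) \<le> \<alpha> * real (opt P x) \<and>
             computes_within M (enc_instance P x) (poly p (length (enc_instance P x)))
               (enc_solution P x s)))"


section \<open>Graphs and signed graphs\<close>

definition all_pairs :: "'a set \<Rightarrow> 'a set set" where
  "all_pairs V = {e. e \<subseteq> V \<and> card e = 2}"

record 'a graph =
  verts :: "'a set"
  edges :: "'a set set"

definition graph_wf :: "'a graph \<Rightarrow> bool" where
  "graph_wf G \<longleftrightarrow> finite (verts G) \<and> edges G \<subseteq> all_pairs (verts G)"

definition vertex_cover :: "'a graph \<Rightarrow> 'a set \<Rightarrow> bool" where
  "vertex_cover G S \<longleftrightarrow> S \<subseteq> verts G \<and> (\<forall>e\<in>edges G. e \<inter> S \<noteq> {})"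

record 'a signed_graph =
  sverts :: "'a set"
  pos_edges :: "'a set set"
  neg_edges :: "'a set set"

definition signed_graph_wf :: "'a signed_graph \<Rightarrow> bool" where
  "signed_graph_wf G \<longleftrightarrow>
     finite (sverts G) \<and>
     pos_edges G \<subseteq> all_pairs (sverts G) \<and> neg_edges G \<subseteq> all_pairs (sverts G) \<and>
     pos_edges G \<inter> neg_edges G = {}"

definition sedges :: "'a signed_graph \<Rightarrow> 'a set set" where
  "sedges G = pos_edges G \<union> neg_edges G"

definition bad_triangle :: "'a signed_graph \<Rightarrow> 'a set \<Rightarrow> bool" where
  "bad_triangle G T \<longleftrightarrow>
     T \<subseteq> sverts G \<and> card T = 3 \<and> all_pairs T \<subseteq> sedges G \<and>
     card (all_pairs T \<inter> neg_edges G) = 1"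

definition bad_triangle_transversal :: "'a signed_graph \<Rightarrow> 'a set set \<Rightarrow> bool" where
  "bad_triangle_transversal G C \<longleftrightarrow>
     C \<subseteq> sedges G \<and> (\<forall>T. bad_triangle G T \<longrightarrow> C \<inter> all_pairs T \<noteq> {})"


section \<open>The two problems\<close>

text \<open>
  Algorithms receive graphs on the vertices \<open>0, \<dots>, n - 1\<close>. A labelling \<open>f\<close> of the vertex pairs
  is written as the lower triangle of its matrix, row by row: row \<open>v\<close> lists \<open>f {u, v}\<close> for
  \<open>u < v\<close> and is closed by the separator 4. Entries are 1 (no edge, not selected),
  2 (edge, positive edge, selected) and 3 (negative edge). An edge set is encoded in the same
  way, a vertex set by its characteristic word.
\<close>

definition enc_pairs :: "nat \<Rightarrow> (nat set \<Rightarrow> nat) \<Rightarrow> nat list" where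
  "enc_pairs n f = concat (map (\<lambda>v. map (\<lambda>u. f {u, v}) [0..<v] @ [4]) [0..<n])"

definition enc_edge_set :: "nat \<Rightarrow> nat set set \<Rightarrow> nat list" where
  "enc_edge_set n C = enc_pairs n (\<lambda>e. if e \<in> C then 2 else 1)"

definition enc_vertex_set :: "nat \<Rightarrow> nat set \<Rightarrow> nat list" where
  "enc_vertex_set n S = map (\<lambda>v. if v \<in> S then 2 else 1) [0..<n]"

definition enc_graph :: "nat graph \<Rightarrow> nat list" where
  "enc_graph G = enc_edge_set (card (verts G)) (edges G)"

definition enc_signed_graph :: "nat signed_graph \<Rightarrow> nat list" where
  "enc_signed_graph G =
     enc_pairs (card (sverts G))
       (\<lambda>e. if e \<in> pos_edges G then 2 else if e \<in> neg_edges G then 3 else 1)"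

definition min_vertex_cover :: "(nat graph, nat set) min_problem" where
  "min_vertex_cover =
     \<lparr>is_instance = (\<lambda>G. graph_wf G \<and> (\<exists>n. verts G = {..<n})),
      feasible = vertex_cover,
      cost = (\<lambda>G S. card S),
      enc_instance = enc_graph,
      enc_solution = (\<lambda>G S. enc_vertex_set (card (verts G)) S)\<rparr>"

definition BTT :: "(nat signed_graph, nat set set) min_problem" where
  "BTT =
     \<lparr>is_instance = (\<lambda>G. signed_graph_wf G \<and> (\<exists>n. sverts G = {..<n})),
      feasible = bad_triangle_transversal,
      cost = (\<lambda>G C. card C),
      enc_instance = enc_signed_graph,
      enc_solution = (\<lambda>G C. enc_edge_set (card (sverts G)) C)\<rparr>"

end

theory Submission
  imports Defs
begin

text \<open>
  Add an apex vertex joined to every vertex of \<open>G\<close> by a positive edge and make the edges of \<open>G\<close>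
  negative. A triangle inside \<open>G\<close> has three negative edges, so the bad triangles are exactly the
  edges of \<open>G\<close> together with the apex. A vertex cover \<open>S\<close> yields the transversal of the apex edges
  to \<open>S\<close>; conversely, replacing every edge of a transversal by its larger endpoint (which is never
  the apex if the apex is vertex 0) yields a vertex cover that is no larger.

  With the apex as vertex 0, each row of the matrix of \<open>G\<close> is just prefixed by one entry, and \<open>v\<close>
  belongs to the cover iff row \<open>v + 1\<close> of the transversal contains a selected entry. Both
  translations are therefore finite-state transductions, performed before and after a simulation
  of the given machine, with one additional tape for the input and the output.
\<close>

section \<open>The reduction\<close>

definition apex_graph :: "nat graph \<Rightarrow> nat signed_graph" where
  "apex_graph G =
     \<lparr>sverts = {..<Suc (card (verts G))},
      pos_edges = (\<lambda>v. {0, Suc v}) ` {..<card (verts G)},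
      neg_edges = (`) Suc ` edges G\<rparr>"

text \<open>Collects the larger endpoints of the edges in \<open>C\<close>, shifted back by the
  renaming of \<open>v\<close> to \<open>Suc v\<close>; the quantifier over \<open>u\<close> ranges
  over one row of the encoded \<open>C\<close>.\<close>

definition cover_of_transversal :: "nat \<Rightarrow> nat set set \<Rightarrow> nat set" where
  "cover_of_transversal n C = {v. v < n \<and> (\<exists>u<Suc v. {u, Suc v} \<in> C)}"

lemma min_vertex_cover_instanceD:
  assumes "is_instance min_vertex_cover G"
  shows "graph_wf G" and "verts G = {..<card (verts G)}"
proof -
  obtain n where "graph_wf G" "verts G = {..<n}"
    using assms unfolding min_vertex_cover_def by (auto simp only: min_problem.simps)
  then show "graph_wf G" "verts G = {..<card (verts G)}" by simp_all
qed

lemma all_pairs_triple: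
  assumes "a \<noteq> b" "a \<noteq> c" "b \<noteq> c"
  shows "all_pairs {a, b, c} = {{a, b}, {a, c}, {b, c}}"
proof
  show "all_pairs {a, b, c} \<subseteq> {{a, b}, {a, c}, {b, c}}"
    using assms by (auto simp: all_pairs_def card_2_iff doubleton_eq_iff)
  show "{{a, b}, {a, c}, {b, c}} \<subseteq> all_pairs {a, b, c}"
    using assms by (auto simp: all_pairs_def)
qed

lemma graph_wf_edgeE:
  fixes G :: "nat graph"
  assumes "graph_wf G" and "e \<in> edges G"
  obtains u v where "e = {u, v}" "u \<noteq> v" "u \<in> verts G" "v \<in> verts G"
  using assms unfolding graph_wf_def all_pairs_def card_2_iff by blast

lemma zero_in_pos_edge: "e \<in> pos_edges (apex_graph G) \<Longrightarrow> 0 \<in> e"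
  by (auto simp: apex_graph_def)

lemma zero_notin_neg_edge: "e \<in> neg_edges (apex_graph G) \<Longrightarrow> 0 \<notin> e"
  by (auto simp: apex_graph_def)

lemma is_instance_apex_graph:
  assumes "is_instance min_vertex_cover G"
  shows "is_instance BTT (apex_graph G)"
proof -
  note G = min_vertex_cover_instanceD[OF assms]
  have "neg_edges (apex_graph G) \<subseteq> all_pairs (sverts (apex_graph G))"
  proof
    fix e assume "e \<in> neg_edges (apex_graph G)"
    then obtain d where d: "d \<in> edges G" "e = Suc ` d" by (auto simp: apex_graph_def)
    from G(1) d(1) obtain u v where uv: "d = {u, v}" "u \<noteq> v" "u \<in> verts G" "v \<in> verts G"
      by (rule graph_wf_edgeE)
    then have "u < card (verts G)" "v < card (verts G)" using G(2) by auto
    then show "e \<in> all_pairs (sverts (apex_graph G))"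
      using uv d by (auto simp: all_pairs_def apex_graph_def)
  qed
  moreover have "pos_edges (apex_graph G) \<subseteq> all_pairs (sverts (apex_graph G))"
    by (auto simp: all_pairs_def apex_graph_def)
  moreover have "pos_edges (apex_graph G) \<inter> neg_edges (apex_graph G) = {}"
    using zero_in_pos_edge zero_notin_neg_edge by blast
  ultimately show ?thesis
    by (auto simp: BTT_def signed_graph_wf_def apex_graph_def)
qed

text \<open>Positive edges contain the apex 0 and negative edges avoid it, so of the three pairs
  only the one opposite the apex is negative.\<close>

lemma bad_triangle_apex_graph:
  assumes "graph_wf G" and "verts G = {..<card (verts G)}" and "{u, v} \<in> edges G"
  shows "bad_triangle (apex_graph G) {0, Suc u, Suc v}"
proof -
  let ?H = "apex_graph G"
  obtain u' v' where "{u, v} = {u', v'}" "u' \<noteq> v'" "u' \<in> verts G" "v' \<in> verts G"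
    using assms(1,3) by (rule graph_wf_edgeE)
  then have uv: "u \<noteq> v" "u < card (verts G)" "v < card (verts G)"
    using assms(2) by (auto simp: doubleton_eq_iff)
  have pairs: "all_pairs {0, Suc u, Suc v} = {{0, Suc u}, {0, Suc v}, {Suc u, Suc v}}"
    using uv(1) by (intro all_pairs_triple) auto
  have neg: "{Suc u, Suc v} \<in> neg_edges ?H"
    using imageI[OF assms(3), of "(`) Suc"] by (simp add: apex_graph_def)
  have "all_pairs {0, Suc u, Suc v} \<inter> neg_edges ?H = {{Suc u, Suc v}}"
    unfolding pairs using neg zero_notin_neg_edge by blast
  moreover have "all_pairs {0, Suc u, Suc v} \<subseteq> sedges ?H"
    unfolding pairs using neg uv by (auto simp: sedges_def apex_graph_def)
  ultimately show ?thesis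
    using uv by (auto simp: bad_triangle_def apex_graph_def)
qed

text \<open>Edges avoiding the apex are all negative, so a triangle without the apex has three
  negative edges and is not bad. Once 0 lies in \<open>T\<close>, the opposite pair is a negative
  edge and hence the shift of an edge of \<open>G\<close>.\<close>

lemma bad_triangle_apex_graphE:
  assumes "bad_triangle (apex_graph G) T"
  obtains e where "e \<in> edges G" "T = insert 0 (Suc ` e)"
proof -
  let ?H = "apex_graph G"
  have card: "card T = 3" and sub: "all_pairs T \<subseteq> sedges ?H"
    and one: "card (all_pairs T \<inter> neg_edges ?H) = 1"
    using assms by (auto simp: bad_triangle_def)
  have neg: "p \<in> neg_edges ?H" if "p \<in> all_pairs T" "0 \<notin> p" for p
    using that sub zero_in_pos_edge by (auto simp: sedges_def)
  have "0 \<in> T"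
  proof (rule ccontr)
    assume "0 \<notin> T"
    then have "all_pairs T \<inter> neg_edges ?H = all_pairs T"
      using neg by (auto simp: all_pairs_def)
    moreover obtain a b c where "T = {a, b, c}" "a \<noteq> b" "a \<noteq> c" "b \<noteq> c"
      using card unfolding card_3_iff by blast
    then have "card (all_pairs T) = 3"
      by (simp add: all_pairs_triple doubleton_eq_iff)
    ultimately show False using one by simp
  qed
  have "card (T - {0}) = 2" using card \<open>0 \<in> T\<close> by simp
  then have "T - {0} \<in> neg_edges ?H" by (intro neg) (auto simp: all_pairs_def)
  then obtain e where "e \<in> edges G" "T - {0} = Suc ` e" by (auto simp: apex_graph_def)
  with \<open>0 \<in> T\<close> show thesis using that by blast
qed

section \<open>From transversals back to vertex covers\<close>

text \<open>Guards against the convention that an infinite set has \<open>card\<close> 0, which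
  would spoil the cost comparison.\<close>

lemma finite_transversal:
  assumes "is_instance min_vertex_cover G" and "feasible BTT (apex_graph G) C"
  shows "finite C"
proof -
  have "finite (edges G)"
    using min_vertex_cover_instanceD[OF assms(1)]
    by (auto simp: graph_wf_def all_pairs_def intro: finite_subset[of _ "Pow (verts G)"])
  then have "finite (sedges (apex_graph G))" by (simp add: sedges_def apex_graph_def)
  then show ?thesis
    using assms(2) by (auto simp: BTT_def bad_triangle_transversal_def intro: finite_subset)
qed

lemma feasible_cover_of_transversal:
  assumes "is_instance min_vertex_cover G" and "feasible BTT (apex_graph G) C"
  shows "feasible min_vertex_cover G (cover_of_transversal (card (verts G)) C)"
proof -
  note G = min_vertex_cover_instanceD[OF assms(1)]
  let ?n = "card (verts G)"
  let ?S = "cover_of_transversal ?n C"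
  have "e \<inter> ?S \<noteq> {}" if e: "e \<in> edges G" for e
  proof -
    obtain u v where uv: "e = {u, v}" "u \<noteq> v" "u \<in> verts G" "v \<in> verts G"
      using G(1) e by (rule graph_wf_edgeE)
    then have n: "u < ?n" "v < ?n" using G(2) by auto
    have "bad_triangle (apex_graph G) {0, Suc u, Suc v}"
      using bad_triangle_apex_graph[OF G] e uv(1) by blast
    then have "C \<inter> all_pairs {0, Suc u, Suc v} \<noteq> {}"
      using assms(2) by (auto simp: BTT_def bad_triangle_transversal_def)
    then have "{0, Suc u} \<in> C \<or> {0, Suc v} \<in> C \<or> {Suc u, Suc v} \<in> C"
      using uv(2) by (simp add: all_pairs_triple)
    moreover have "u \<in> ?S" if "{0, Suc u} \<in> C"
      using that n by (auto simp: cover_of_transversal_def)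
    moreover have "v \<in> ?S" if "{0, Suc v} \<in> C"
      using that n by (auto simp: cover_of_transversal_def)
    moreover have "u \<in> ?S \<or> v \<in> ?S" if "{Suc u, Suc v} \<in> C"
    \<comment> \<open>The edge opposite the apex puts its larger endpoint into the cover; which of
      the two that is does not matter.\<close>
    proof (cases "u < v")
      case True
      with that n show ?thesis by (auto simp: cover_of_transversal_def)
    next
      case False
      with that n uv(2) have "Suc v < Suc u" "{Suc v, Suc u} \<in> C"
        by (simp_all add: insert_commute)
      with n show ?thesis by (auto simp: cover_of_transversal_def)
    qed
    ultimately show ?thesis using uv(1) by blast
  qed
  moreover have "?S \<subseteq> verts G"
    using G(2) by (auto simp: cover_of_transversal_def)
  ultimately show ?thesis by (simp add: min_vertex_cover_def vertex_cover_def)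
qed

text \<open>Every chosen vertex is recovered from an edge of \<open>C\<close> as its maximum minus
  1, so the cover lies in an image of \<open>C\<close>.\<close>

lemma card_cover_of_transversal_le:
  assumes "finite C"
  shows "card (cover_of_transversal n C) \<le> card C"
proof -
  have "cover_of_transversal n C \<subseteq> (\<lambda>e. Max e - 1) ` C"
  proof
    fix v assume "v \<in> cover_of_transversal n C"
    then obtain u where u: "u < Suc v" "{u, Suc v} \<in> C"
      by (auto simp: cover_of_transversal_def)
    then have "Max {u, Suc v} - 1 = v" by simp
    with u(2) show "v \<in> (\<lambda>e. Max e - 1) ` C" by (metis imageI)
  qed
  then show ?thesis using assms by (meson card_image_le card_mono finite_imageI order_trans)
qed

section \<open>Comparison of the optima\<close>

lemma opt_le:
  assumes "feasible P x s"
  shows "opt P x \<le> cost P x s"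
  unfolding opt_def using assms by (intro Least_le) blast

lemma opt_attained:
  assumes "feasible P x s"
  obtains s' where "feasible P x s'" "cost P x s' = opt P x"
proof -
  have "\<exists>s'. feasible P x s' \<and> cost P x s' = opt P x"
    unfolding opt_def by (rule LeastI[of _ "cost P x s"]) (use assms in blast)
  then show thesis using that by blast
qed

lemma opt_apex_graph_le:
  assumes "is_instance min_vertex_cover G"
  shows "opt BTT (apex_graph G) \<le> opt min_vertex_cover G"
proof -
  note G = min_vertex_cover_instanceD[OF assms]
  \<comment> \<open>Some cover must exist for the \<open>LEAST\<close> in \<open>opt\<close> to be
    attained; the set of all vertices is one.\<close>
  have "feasible min_vertex_cover G (verts G)"
    using G(1) by (auto simp: min_vertex_cover_def vertex_cover_def elim!: graph_wf_edgeE)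
  then obtain S where S: "feasible min_vertex_cover G S"
    and opt: "cost min_vertex_cover G S = opt min_vertex_cover G"
    by (rule opt_attained)
  have sub: "S \<subseteq> verts G" and cover: "\<And>e. e \<in> edges G \<Longrightarrow> e \<inter> S \<noteq> {}"
    using S by (auto simp: min_vertex_cover_def vertex_cover_def)
  let ?C = "(\<lambda>v. {0, Suc v}) ` S"
  have "?C \<inter> all_pairs T \<noteq> {}" if T: "bad_triangle (apex_graph G) T" for T
  proof -
    obtain e where e: "e \<in> edges G" "T = insert 0 (Suc ` e)"
      using T by (rule bad_triangle_apex_graphE)
    then obtain v where "v \<in> e" "v \<in> S" using cover by blast
    then have "{0, Suc v} \<in> ?C \<inter> all_pairs T" using e(2) by (auto simp: all_pairs_def)
    then show ?thesis by blast
  qed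
  moreover have "?C \<subseteq> sedges (apex_graph G)"
    using sub G(2) by (auto simp: sedges_def apex_graph_def)
  ultimately have "feasible BTT (apex_graph G) ?C"
    by (simp add: BTT_def bad_triangle_transversal_def)
  then have "opt BTT (apex_graph G) \<le> cost BTT (apex_graph G) ?C" by (rule opt_le)
  also have "\<dots> \<le> card S"
    using sub G(1) by (auto simp: BTT_def graph_wf_def intro: card_image_le finite_subset)
  also have "\<dots> = opt min_vertex_cover G" using opt by (simp add: min_vertex_cover_def)
  finally show ?thesis .
qed


section \<open>The encodings as rows\<close>

definition enc_rows :: "nat list list \<Rightarrow> nat list" where
  "enc_rows rs = concat (map (\<lambda>r. r @ [4]) rs)"

definition pair_rows :: "nat \<Rightarrow> (nat set \<Rightarrow> nat) \<Rightarrow> nat list list" where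
  "pair_rows n f = map (\<lambda>v. map (\<lambda>u. f {u, v}) [0..<v]) [0..<n]"

text \<open>The leading 2 is the positive apex edge; the old edge entries 2 become negative, that is
  3.\<close>

definition apex_row :: "nat list \<Rightarrow> nat list" where
  "apex_row r = 2 # map (\<lambda>x. if x = 2 then 3 else x) r"

definition row_mark :: "nat list \<Rightarrow> nat" where
  "row_mark r = (if 2 \<in> set r then 2 else 1)"

lemma enc_rows_simps [simp]:
  "enc_rows [] = []" "enc_rows (r # rs) = r @ 4 # enc_rows rs"
  by (simp_all add: enc_rows_def)

lemma enc_pairs_eq_enc_rows: "enc_pairs n f = enc_rows (pair_rows n f)"
  by (simp add: enc_pairs_def enc_rows_def pair_rows_def comp_def)

lemma length_pair_rows [simp]: "length (pair_rows n f) = n"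
  by (simp add: pair_rows_def)

text \<open>Each row contributes its separator. This bounds the number of vertices by the length of
  the input, so that time bounds can be stated in that length alone.\<close>

lemma length_le_enc_rows: "length rs \<le> length (enc_rows rs)"
  by (induction rs) auto

lemma length_enc_rows_apex: "length (enc_rows (map apex_row rs)) = length (enc_rows rs) + length rs"
  by (induction rs) (auto simp: apex_row_def)

lemma length_enc_rows: "length (enc_rows rs) = sum_list (map length rs) + length rs"
  by (induction rs) auto

lemma zero_notin_enc_rows: "\<forall>r\<in>set rs. 0 \<notin> set r \<Longrightarrow> 0 \<notin> set (enc_rows rs)"
  by (induction rs) auto

lemma pair_rows_Suc:
  "pair_rows (Suc n) f = [] # map (\<lambda>v. map (\<lambda>u. f {u, Suc v}) [0..<Suc v]) [0..<n]"
  by (simp add: pair_rows_def upt_conv_Cons map_Suc_upt[symmetric] comp_def del: upt_Suc)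

text \<open>Row \<open>v + 1\<close> has one entry more than row \<open>v\<close>, whatever the
  labels; \<open>f\<close> will label the transversal and \<open>g\<close> the graph.\<close>

lemma length_enc_tl_pair_rows:
  "length (enc_rows (tl (pair_rows (Suc n) f))) = length (enc_rows (pair_rows n g)) + n"
proof -
  have "map length (tl (pair_rows (Suc n) f)) = map Suc (map length (pair_rows n g))"
    by (simp add: pair_rows_Suc) (simp add: pair_rows_def)
  then show ?thesis
    using sum_list_Suc[of "\<lambda>x. x" "map length (pair_rows n g)"]
    by (simp add: length_enc_rows del: map_map)
qed

lemma enc_apex_graph:
  "enc_instance BTT (apex_graph G) =
     enc_rows ([] # map apex_row (pair_rows (card (verts G)) (\<lambda>e. if e \<in> edges G then 2 else 1)))"
proof -
  let ?n = "card (verts G)"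
  let ?f = "\<lambda>e. if e \<in> pos_edges (apex_graph G) then 2
                 else if e \<in> neg_edges (apex_graph G) then 3 else (1::nat)"
  have f0: "?f {0, Suc v} = 2" if "v < ?n" for v
    using that by (auto simp: apex_graph_def)
  have fS: "?f {Suc u, Suc v} = (if {u, v} \<in> edges G then 3 else 1)" for u v
  proof -
    have "{Suc u, Suc v} \<notin> pos_edges (apex_graph G)" using zero_in_pos_edge by fastforce
    moreover have "Suc ` {u, v} \<in> neg_edges (apex_graph G) \<longleftrightarrow> {u, v} \<in> edges G"
      by (auto simp: apex_graph_def inj_image_eq_iff simp del: image_insert)
    ultimately show ?thesis by simp
  qed
  \<comment> \<open>Splitting off \<open>u = 0\<close> gives the apex entry; reindexing the others
    by \<open>Suc\<close> gives the relabelled row of \<open>v\<close>.\<close>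
  have "map (\<lambda>u. ?f {u, Suc v}) [0..<Suc v] =
      apex_row (map (\<lambda>u. if {u, v} \<in> edges G then 2 else 1) [0..<v])" if "v < ?n" for v
    unfolding upt_conv_Cons[OF zero_less_Suc] map_Suc_upt[symmetric]
    by (simp add: f0[OF that] fS apex_row_def)
  then have "pair_rows (Suc ?n) ?f =
      [] # map apex_row (pair_rows ?n (\<lambda>e. if e \<in> edges G then 2 else 1))"
    by (simp add: pair_rows_Suc) (simp add: pair_rows_def)
  then show ?thesis
    by (simp add: BTT_def enc_signed_graph_def enc_pairs_eq_enc_rows)
       (simp add: apex_graph_def enc_pairs_eq_enc_rows)
qed

lemma enc_instance_min_vertex_cover:
  "enc_instance min_vertex_cover G =
     enc_rows (pair_rows (card (verts G)) (\<lambda>e. if e \<in> edges G then 2 else 1))"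
  by (simp add: min_vertex_cover_def enc_graph_def enc_edge_set_def enc_pairs_eq_enc_rows)

lemma row_mark_transversal:
  "map row_mark (tl (pair_rows (Suc n) (\<lambda>e. if e \<in> C then 2 else 1))) =
     enc_vertex_set n (cover_of_transversal n C)"
  by (auto simp: pair_rows_Suc row_mark_def enc_vertex_set_def cover_of_transversal_def
      simp del: upt_Suc)


section \<open>Tapes\<close>

text \<open>The left part is listed from the head outwards.\<close>

definition split_tape :: "nat list \<Rightarrow> nat list \<Rightarrow> tape" where
  "split_tape l r = (\<lambda>i. if i < 0 then input_tape l (- i - 1) else input_tape r i)"

lemma input_tape_split: "input_tape w = split_tape [] w"
  by (auto simp: split_tape_def input_tape_def)

lemma blank_tape_split: "blank_tape = split_tape [] []"
  by (auto simp: split_tape_def input_tape_def blank_tape_def)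

lemma split_tape_head [simp]:
  "split_tape l [] 0 = 0" "split_tape l (x # r) 0 = x"
  by (auto simp: split_tape_def input_tape_def)

text \<open>A blank written next to the empty left part changes nothing, so a tape erased from left
  to right keeps an empty left part.\<close>

lemma split_tape_zero [simp]: "split_tape [0] r = split_tape [] r"
  by (auto simp: split_tape_def input_tape_def)

lemma act_stay [simp]: "act (t 0, MStay) t = t"
  by (auto simp: act_def)

text \<open>Since \<open>tl [] = []\<close>, this also covers writing at the right end of the
  word.\<close>

lemma act_right_split: "act (x, MRight) (split_tape l r) = split_tape (x # l) (tl r)"
proof
  fix i :: int
  consider "i < -1" | "i = -1" | "i \<ge> 0" by linarith
  then show "act (x, MRight) (split_tape l r) i = split_tape (x # l) (tl r) i"
  proof cases
    case 1
    then have "nat (- i - 1) = Suc (nat (- (i + 1) - 1))" by linarith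
    with 1 show ?thesis by (auto simp: act_def split_tape_def input_tape_def)
  next
    case 2
    then show ?thesis by (simp add: act_def split_tape_def input_tape_def)
  next
    case 3
    then have "nat (i + 1) = Suc (nat i)" by linarith
    with 3 show ?thesis by (auto simp: act_def split_tape_def input_tape_def nth_tl)
  qed
qed

text \<open>The hypothesis says that the scanned symbol is kept; for empty \<open>r\<close> this is
  the blank.\<close>

lemma act_left_split:
  assumes "x = split_tape (y # l) r 0"
  shows "act (x, MLeft) (split_tape (y # l) r) = split_tape l (y # r)"
proof
  fix i :: int
  consider "i < 0" | "i = 0" | "i > 0" by linarith
  then show "act (x, MLeft) (split_tape (y # l) r) i = split_tape l (y # r) i"
  proof cases
    case 1
    then have "nat (- i) = Suc (nat (- i - 1))" by linarith
    with 1 show ?thesis by (auto simp: act_def split_tape_def input_tape_def)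
  next
    case 2
    then show ?thesis by (simp add: act_def split_tape_def input_tape_def)
  next
    case 3
    then have "nat i = Suc (nat (i - 1))" by linarith
    with 3 assms show ?thesis by (auto simp: act_def split_tape_def input_tape_def)
  qed
qed

text \<open>The given machine may leave arbitrary symbols around its output, so its tape has no
  known split form; decoding consumes the output through \<open>reads\<close>, one symbol at a
  time.\<close>

lemma reads_ConsD:
  assumes "reads t (x # w)"
  shows "t 0 = x" and "x \<noteq> 0" and "reads (act (x, MRight) t) w"
proof -
  have t: "t (int i) = (x # w) ! i" if "i < length (x # w)" for i
    using assms that by (simp add: reads_def)
  show "t 0 = x" using t[of 0] by simp
  show "x \<noteq> 0" using assms by (auto simp: reads_def)
  have "act (x, MRight) t (int i) = w ! i" if "i < length w" for i
    using t[of "Suc i"] that by (simp add: act_def add.commute)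
  then show "reads (act (x, MRight) t) w"
    using assms by (auto simp: reads_def act_def add.commute)
qed

lemma reads_NilD: "reads t [] \<Longrightarrow> t 0 = 0"
  by (simp add: reads_def)

lemma reads_split_tape: "0 \<notin> set w \<Longrightarrow> reads (split_tape l w) w"
  by (auto simp: reads_def split_tape_def input_tape_def)


section \<open>Bounded runs\<close>

text \<open>A bound instead of an exact count lets runs be composed by adding bounds and estimated
  generously.\<close>

definition reaches :: "tm \<Rightarrow> nat \<Rightarrow> config \<Rightarrow> config \<Rightarrow> bool" where
  "reaches M b c c' \<longleftrightarrow> (\<exists>n\<le>b. (tm_step M ^^ n) c = c')"

lemma reaches_refl: "reaches M b c c"
  unfolding reaches_def by (rule exI[of _ 0]) simp

lemma reaches_step: "tm_step M c = c' \<Longrightarrow> reaches M 1 c c'"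
  unfolding reaches_def by (rule exI[of _ 1]) simp

lemma reaches_trans:
  assumes "reaches M a c d" and "reaches M b d e"
  shows "reaches M (a + b) c e"
proof -
  obtain m n where "m \<le> a" "(tm_step M ^^ m) c = d" "n \<le> b" "(tm_step M ^^ n) d = e"
    using assms by (auto simp: reaches_def)
  then have "n + m \<le> a + b" "(tm_step M ^^ (n + m)) c = e" by (simp_all add: funpow_add)
  then show ?thesis unfolding reaches_def by blast
qed

lemma reaches_Suc:
  assumes "tm_step M c = d" and "reaches M b d e"
  shows "reaches M (Suc b) c e"
  using reaches_trans[OF reaches_step[OF assms(1)] assms(2)] by simp

lemma reaches_mono: "reaches M a c d \<Longrightarrow> a \<le> b \<Longrightarrow> reaches M b c d"
  unfolding reaches_def using le_trans by blast

lemma tm_step_halted: "(tm_step M ^^ n) (num_states M, ts) = (num_states M, ts)"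
  by (induction n) (simp_all add: tm_step_def)

section \<open>Preservation of the alphabet and of the number of tapes\<close>

text \<open>\<open>tm_wf\<close> restricts transitions only on scanned words over the alphabet, so
  preservation of the number of tapes is proved together with a bound on all cells.\<close>

definition over_alphabet :: "tm \<Rightarrow> tape list \<Rightarrow> bool" where
  "over_alphabet M ts \<longleftrightarrow>
     length ts = num_tapes M \<and> (\<forall>t\<in>set ts. \<forall>i. t i < num_symbols M)"

lemma over_alphabet_init:
  assumes "tm_wf M" and "set w \<subseteq> {..<num_symbols M}"
  shows "over_alphabet M (snd (init_config M w))"
proof -
  have M: "num_tapes M \<ge> 1" "num_symbols M \<ge> 1" using assms(1) by (simp_all add: tm_wf_def)
  have "w ! j < num_symbols M" if "j < length w" for j
    using assms(2) nth_mem[OF that] by blast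
  then have "input_tape w i < num_symbols M" for i
    using M(2) by (simp add: input_tape_def nat_less_iff)
  then show ?thesis
    using M by (cases "num_tapes M") (auto simp: over_alphabet_def init_config_def blank_tape_def)
qed

lemma over_alphabet_step:
  assumes "tm_wf M" and "over_alphabet M (snd c)"
  shows "over_alphabet M (snd (tm_step M c))"
proof (cases "fst c < num_states M")
  case True
  obtain q ts where c: "c = (q, ts)" by fastforce
  obtain q' as where t: "trans M q (map (\<lambda>t. t 0) ts) = (q', as)" by fastforce
  have "length (map (\<lambda>t. t 0) ts) = num_tapes M"
    "set (map (\<lambda>t. t 0) ts) \<subseteq> {..<num_symbols M}"
    using assms(2) c by (auto simp: over_alphabet_def)
  then have as: "length as = num_tapes M" "fst ` set as \<subseteq> {..<num_symbols M}"
    using assms(1) True c t unfolding tm_wf_def by (metis fst_conv snd_conv)+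
  have "act a t i < num_symbols M" if "(a, t) \<in> set (zip as ts)" for a t i
    using set_zip_leftD[OF that] set_zip_rightD[OF that] as(2) assms(2) c
    by (auto simp: act_def over_alphabet_def)
  then show ?thesis
    using True as(1) assms(2) c t by (auto simp: tm_step_def over_alphabet_def)
next
  case False
  then show ?thesis using assms(2) by (auto simp: tm_step_def split: prod.splits)
qed

lemma over_alphabet_funpow:
  assumes "tm_wf M" and "over_alphabet M (snd c)"
  shows "over_alphabet M (snd ((tm_step M ^^ n) c))"
  using assms by (induction n) (simp_all add: over_alphabet_step)

lemma computes_within_mono:
  assumes "computes_within M w m v" and "m \<le> n"
  shows "computes_within M w n v"
proof -
  obtain ts where ts: "(tm_step M ^^ m) (init_config M w) = (num_states M, ts)" "reads (hd ts) v"
    using assms(1) by (auto simp: computes_within_def)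
  have "(tm_step M ^^ (n - m + m)) (init_config M w) = (num_states M, ts)"
    unfolding funpow_add using ts(1) by (simp add: tm_step_halted)
  then show ?thesis using ts(2) assms(2) unfolding computes_within_def by auto
qed

lemma computes_withinI:
  assumes "reaches M b (init_config M w) (num_states M, ts)" and "b \<le> n" and "reads (hd ts) v"
  shows "computes_within M w n v"
proof -
  obtain k where "k \<le> b" "(tm_step M ^^ k) (init_config M w) = (num_states M, ts)"
    using assms(1) by (auto simp: reaches_def)
  then have "computes_within M w k v" using assms(3) by (auto simp: computes_within_def)
  then show ?thesis using \<open>k \<le> b\<close> assms(2) by (auto intro: computes_within_mono)
qed



section \<open>The machine\<close>

text \<open>
  Let \<open>m\<close> be the number of states of the given machine, whose states and tapes are shifted by 4
  and by 1. States 0 to 3 translate the instance from tape 0 to tape 1, erasing tape 0 (0: the row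
  of the apex, 1: start of a row, 2: inside a row, 3: rewind tape 1). States \<open>m + 4\<close> to \<open>m + 7\<close>
  translate the solution from tape 1 to tape 0 (\<open>m + 4\<close>: the row of the apex, \<open>m + 5\<close> and
  \<open>m + 6\<close>: inside a row, without and with a selected entry so far, \<open>m + 7\<close>: rewind tape 0).
  The arguments \<open>x\<close> and \<open>y\<close> are the symbols scanned on tapes 0 and 1.
\<close>

definition translate ::
  "nat \<Rightarrow> nat \<Rightarrow> nat \<Rightarrow> nat \<Rightarrow> nat \<times> (nat \<times> move) \<times> (nat \<times> move)" where
  "translate m q x y =
     (if q = 0 then (1, (x, MStay), (4, MRight))
      else if q = 1 then
        if x = 0 then (3, (x, MStay), (y, MLeft)) else (2, (x, MStay), (2, MRight))
      else if q = 2 then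
        if x = 4 then (1, (0, MRight), (4, MRight))
        else (2, (0, MRight), (if x = 2 then 3 else x, MRight))
      else if q = 3 then
        if y = 0 then (4, (x, MStay), (y, MRight)) else (3, (x, MStay), (y, MLeft))
      else if q = m + 4 then (m + 5, (x, MStay), (y, MRight))
      else if q = m + 5 then
        if y = 0 then (m + 7, (x, MLeft), (y, MStay))
        else if y = 4 then (m + 5, (1, MRight), (y, MRight))
        else if y = 2 then (m + 6, (x, MStay), (y, MRight))
        else (m + 5, (x, MStay), (y, MRight))
      else if q = m + 6 then
        if y = 4 then (m + 5, (2, MRight), (y, MRight)) else (m + 6, (x, MStay), (y, MRight))
      else
        if x = 0 then (m + 8, (x, MRight), (y, MStay)) else (m + 7, (x, MLeft), (y, MStay)))"

text \<open>State 4 is the shifted initial state and \<open>num_states M + 4\<close> the shifted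
  halting state. The latter is also the first decoding state, so control passes on without extra
  steps.\<close>

definition vc_tm :: "tm \<Rightarrow> tm" where
  "vc_tm M =
     \<lparr>num_tapes = Suc (num_tapes M),
      num_states = num_states M + 8,
      num_symbols = num_symbols M,
      trans = (\<lambda>q xs.
        if 4 \<le> q \<and> q < num_states M + 4
        then let (q', as) = trans M (q - 4) (tl xs) in (q' + 4, (hd xs, MStay) # as)
        else let (q', a, b) = translate (num_states M) q (xs ! 0) (xs ! 1)
             in (q', a # b # map (\<lambda>z. (z, MStay)) (drop 2 xs)))\<rparr>"

lemma vc_tm_simps [simp]:
  "num_tapes (vc_tm M) = Suc (num_tapes M)"
  "num_states (vc_tm M) = num_states M + 8"
  "num_symbols (vc_tm M) = num_symbols M"
  by (simp_all add: vc_tm_def)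

lemma translate_bounds:
  assumes "translate m q x y = (q', a, b)" and "x < s" "y < s" "5 \<le> s"
  shows "q' \<le> m + 8 \<and> fst a < s \<and> fst b < s"
  using assms by (auto simp: translate_def split: if_splits)

lemma tm_wf_vc_tm:
  assumes "tm_wf M" and "5 \<le> num_symbols M"
  shows "tm_wf (vc_tm M)"
  unfolding tm_wf_def
proof (intro conjI allI impI; (elim conjE)?)
  show "num_tapes (vc_tm M) \<ge> 1" by simp
  show "num_symbols (vc_tm M) \<ge> 1" using assms(2) by simp
next
  fix q xs
  assume q: "q < num_states (vc_tm M)" and len: "length xs = num_tapes (vc_tm M)"
    and set: "set xs \<subseteq> {..<num_symbols (vc_tm M)}"
  have "num_tapes M \<ge> 1" using assms(1) by (simp add: tm_wf_def)
  then obtain x y zs where xs: "xs = x # y # zs"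
    using len by (cases xs; cases "tl xs") auto
  let ?r = "trans (vc_tm M) q xs"
  have "fst ?r \<le> num_states (vc_tm M) \<and> length (snd ?r) = num_tapes (vc_tm M) \<and>
      fst ` set (snd ?r) \<subseteq> {..<num_symbols (vc_tm M)}"
  proof (cases "4 \<le> q \<and> q < num_states M + 4")
    case True
    obtain q' as where t: "trans M (q - 4) (y # zs) = (q', as)" by fastforce
    have "q - 4 < num_states M" "length (y # zs) = num_tapes M"
      "set (y # zs) \<subseteq> {..<num_symbols M}"
      using True len set xs by auto
    then have "q' \<le> num_states M \<and> length as = num_tapes M \<and> fst ` set as \<subseteq> {..<num_symbols M}"
      using assms(1) t unfolding tm_wf_def by (metis fst_conv snd_conv)
    moreover have "?r = (q' + 4, (x, MStay) # as)"
      using True t xs by (simp add: vc_tm_def)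
    ultimately show ?thesis using set xs by simp
  next
    case False
    obtain q' a b where t: "translate (num_states M) q x y = (q', a, b)" by (metis prod_cases3)
    have "q' \<le> num_states M + 8 \<and> fst a < num_symbols M \<and> fst b < num_symbols M"
      using translate_bounds[OF t, of "num_symbols M"] set xs assms(2) by simp
    moreover have "?r = (q', a # b # map (\<lambda>z. (z, MStay)) zs)"
      using False t xs by (auto simp: vc_tm_def)
    ultimately show ?thesis using len set xs by auto
  qed
  then show "fst ?r \<le> num_states (vc_tm M)" "length (snd ?r) = num_tapes (vc_tm M)"
    "fst ` set (snd ?r) \<subseteq> {..<num_symbols (vc_tm M)}" by blast+
qed

section \<open>Steps and simulation\<close>

lemma map2_act_stay: "map2 act (map (\<lambda>z. (z, MStay)) (map (\<lambda>t. t 0) ts)) ts = ts"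
  by (induction ts) auto

lemma step_translate:
  assumes "q < 4 \<or> num_states M + 4 \<le> q \<and> q < num_states M + 8"
  shows "tm_step (vc_tm M) (q, t0 # t1 # ts) =
     (case translate (num_states M) q (t0 0) (t1 0) of
        (q', a, b) \<Rightarrow> (q', act a t0 # act b t1 # ts))"
proof -
  obtain q' a b where t: "translate (num_states M) q (t0 0) (t1 0) = (q', a, b)"
    by (metis prod_cases3)
  then have "trans (vc_tm M) q (map (\<lambda>t. t 0) (t0 # t1 # ts)) =
      (q', a # b # map (\<lambda>z. (z, MStay)) (map (\<lambda>t. t 0) ts))"
    using assms by (auto simp: vc_tm_def)
  then show ?thesis using assms t map2_act_stay[of ts] by (auto simp: tm_step_def)
qed

lemma step_simulate:
  assumes "q < num_states M" and "tm_step M (q, ts) = (q', ts')"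
  shows "tm_step (vc_tm M) (q + 4, t0 # ts) = (q' + 4, t0 # ts')"
  using assms by (auto simp: tm_step_def vc_tm_def split: prod.splits)

text \<open>\<open>M\<close> may halt early and idle for the remaining steps, whereas the new
  machine would go on decoding; hence \<open>n\<close> is only an upper bound.\<close>

lemma run_simulate:
  assumes "(tm_step M ^^ n) (q, ts) = (num_states M, ts')"
  shows "reaches (vc_tm M) n (q + 4, t0 # ts) (num_states M + 4, t0 # ts')"
  using assms
proof (induction n arbitrary: q ts)
  case 0
  then show ?case by (simp add: reaches_refl)
next
  case (Suc n)
  obtain q1 ts1 where s: "tm_step M (q, ts) = (q1, ts1)" by fastforce
  have n: "(tm_step M ^^ n) (q1, ts1) = (num_states M, ts')"
    using Suc.prems s by (simp add: funpow_swap1)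
  show ?case
  proof (cases "q < num_states M")
    case True
    then show ?thesis using reaches_Suc[OF step_simulate[OF True s] Suc.IH[OF n]] by simp
  next
    case False
    then have "q1 = q" "ts1 = ts" using s by (auto simp: tm_step_def)
    then show ?thesis using Suc.IH[OF n] by (auto intro: reaches_mono)
  qed
qed

section \<open>Translating the instance\<close>

text \<open>The row has no inner separator, so state 2 is left exactly at its end. Tape 0 is erased
  on the way, which leaves it blank for the later output.\<close>

lemma run_encode_row:
  assumes "0 \<notin> set r" "4 \<notin> set r"
  shows "reaches (vc_tm M) (Suc (length r))
     (2, split_tape [] (r @ 4 # w) # split_tape l [] # ts)
     (1, split_tape [] w
         # split_tape (rev (map (\<lambda>x. if x = 2 then 3 else x) r @ [4]) @ l) [] # ts)"
  using assms
proof (induction r arbitrary: l)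
  case Nil
  have "tm_step (vc_tm M) (2, split_tape [] (4 # w) # split_tape l [] # ts) =
      (1, split_tape [] w # split_tape (4 # l) [] # ts)"
    by (simp add: step_translate translate_def act_right_split)
  from reaches_Suc[OF this reaches_refl] show ?case by simp
next
  case (Cons x r)
  have "tm_step (vc_tm M) (2, split_tape [] (x # r @ 4 # w) # split_tape l [] # ts) =
      (2, split_tape [] (r @ 4 # w) # split_tape ((if x = 2 then 3 else x) # l) [] # ts)"
    using Cons.prems by (simp add: step_translate translate_def act_right_split)
  from reaches_Suc[OF this Cons.IH] Cons.prems show ?case by simp
qed

text \<open>One step per input symbol, and one more per row for writing the apex entry.\<close>

lemma run_encode_rows:
  assumes "\<forall>r\<in>set rs. set r \<subseteq> {1, 2}"
  shows "reaches (vc_tm M) (length (enc_rows rs) + length rs)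
     (1, split_tape [] (enc_rows rs) # split_tape l [] # ts)
     (1, split_tape [] [] # split_tape (rev (enc_rows (map apex_row rs)) @ l) [] # ts)"
  using assms
proof (induction rs arbitrary: l)
  case Nil
  show ?case by (simp add: reaches_refl)
next
  case (Cons r rs)
  let ?w = "r @ 4 # enc_rows rs"
  have r: "0 \<notin> set r" "4 \<notin> set r" using Cons.prems by auto
  \<comment> \<open>Even an empty row starts with its separator, so state 1 does not take it for the
    end of the input.\<close>
  have x: "split_tape [] ?w 0 \<noteq> 0" using r by (cases r) auto
  then have "tm_step (vc_tm M) (1, split_tape [] ?w # split_tape l [] # ts) =
      (2, split_tape [] ?w # split_tape (2 # l) [] # ts)"
    by (simp add: step_translate translate_def act_right_split)
  from reaches_Suc[OF this reaches_trans[OF run_encode_row[OF r] Cons.IH]] Cons.prems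
  show ?case by (simp add: apex_row_def ac_simps)
qed

text \<open>The tape is given as it is before the left move by which the rewinding loop is entered; this
  also covers an empty word.\<close>

lemma run_rewind_instance:
  assumes "0 \<notin> set l"
  shows "reaches (vc_tm M) (Suc (length l))
     (3, t # act (split_tape l r 0, MLeft) (split_tape l r) # ts)
     (4, t # split_tape [] (rev l @ r) # ts)"
  using assms
proof (induction l arbitrary: r)
  case Nil
  let ?t = "act (split_tape [] r 0, MLeft) (split_tape [] r)"
  \<comment> \<open>The head is on the blank just before the word; one move right ends the
    loop.\<close>
  have "?t 0 = 0" by (simp add: act_def split_tape_def input_tape_def)
  moreover have "act (0, MRight) ?t = split_tape [] r"
    by (auto simp: act_def split_tape_def input_tape_def)
  ultimately have "tm_step (vc_tm M) (3, t # ?t # ts) = (4, t # split_tape [] r # ts)"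
    by (simp add: step_translate translate_def)
  from reaches_Suc[OF this reaches_refl] show ?case by simp
next
  case (Cons y l)
  have "tm_step (vc_tm M) (3, t # split_tape l (y # r) # ts) =
      (3, t # act (split_tape l (y # r) 0, MLeft) (split_tape l (y # r)) # ts)"
    using Cons.prems by (simp add: step_translate translate_def)
  from reaches_Suc[OF this Cons.IH] Cons.prems show ?case by (simp add: act_left_split)
qed

lemma run_rewind_solution:
  assumes "0 \<notin> set l"
  shows "reaches (vc_tm M) (Suc (length l))
     (num_states M + 7, act (split_tape l r 0, MLeft) (split_tape l r) # t # ts)
     (num_states M + 8, split_tape [] (rev l @ r) # t # ts)"
  using assms
proof (induction l arbitrary: r)
  case Nil
  let ?t = "act (split_tape [] r 0, MLeft) (split_tape [] r)"
  have "?t 0 = 0" by (simp add: act_def split_tape_def input_tape_def)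
  moreover have "act (0, MRight) ?t = split_tape [] r"
    by (auto simp: act_def split_tape_def input_tape_def)
  ultimately have "tm_step (vc_tm M) (num_states M + 7, ?t # t # ts) =
      (num_states M + 8, split_tape [] r # t # ts)"
    by (simp add: step_translate translate_def)
  from reaches_Suc[OF this reaches_refl] show ?case by simp
next
  case (Cons y l)
  have "tm_step (vc_tm M) (num_states M + 7, split_tape l (y # r) # t # ts) =
      (num_states M + 7, act (split_tape l (y # r) 0, MLeft) (split_tape l (y # r)) # t # ts)"
    using Cons.prems by (simp add: step_translate translate_def)
  from reaches_Suc[OF this Cons.IH] Cons.prems show ?case by (simp add: act_left_split)
qed

lemma run_encode:
  assumes "\<forall>r\<in>set rs. set r \<subseteq> {1, 2}"
  shows "reaches (vc_tm M) (2 * length (enc_rows rs) + 2 * length rs + 4)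
     (0, split_tape [] (enc_rows rs) # split_tape [] [] # ts)
     (4, split_tape [] [] # split_tape [] (enc_rows ([] # map apex_row rs)) # ts)"
proof -
  let ?w = "enc_rows ([] # map apex_row rs)"
  \<comment> \<open>The 4 written first closes the empty row of the apex.\<close>
  have start: "tm_step (vc_tm M) (0, split_tape [] (enc_rows rs) # split_tape [] [] # ts) =
      (1, split_tape [] (enc_rows rs) # split_tape [4] [] # ts)"
    by (simp add: step_translate translate_def act_right_split)
  have "tm_step (vc_tm M) (1, split_tape [] [] # split_tape (rev ?w) [] # ts) =
      (3, split_tape [] [] # act (split_tape (rev ?w) [] 0, MLeft) (split_tape (rev ?w) []) # ts)"
    using act_stay[of "split_tape [] []"] by (simp add: step_translate translate_def)
  moreover have "0 \<notin> set (rev ?w)"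
    unfolding set_rev using assms
    by (intro zero_notin_enc_rows) (fastforce simp: apex_row_def)
  ultimately have "reaches (vc_tm M) (Suc (Suc (length (rev ?w))))
      (1, split_tape [] [] # split_tape (rev ?w) [] # ts)
      (4, split_tape [] [] # split_tape [] (rev (rev ?w) @ []) # ts)"
    by (rule reaches_Suc[OF _ run_rewind_instance])
  then have rewind: "reaches (vc_tm M) (Suc (Suc (length ?w)))
      (1, split_tape [] [] # split_tape (rev (enc_rows (map apex_row rs)) @ [4]) [] # ts)
      (4, split_tape [] [] # split_tape [] ?w # ts)"
    by simp
  \<comment> \<open>One start step, the rows, and two steps more than the length of
    \<open>?w\<close> for turning and rewinding.\<close>
  show ?thesis
    by (rule reaches_mono[OF reaches_Suc[OF start
          reaches_trans[OF run_encode_rows[OF assms] rewind]]])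
       (simp add: length_enc_rows_apex)
qed

section \<open>Translating the solution\<close>

text \<open>\<open>b\<close> tells whether a selected entry has been seen earlier in the row.\<close>

lemma run_decode_row:
  assumes "4 \<notin> set r" and "reads t (r @ 4 # w)"
  shows "\<exists>t'. reads t' w \<and> reaches (vc_tm M) (Suc (length r))
     (num_states M + (if b then 6 else 5), split_tape l [] # t # ts)
     (num_states M + 5, split_tape ((if b \<or> 2 \<in> set r then 2 else 1) # l) [] # t' # ts)"
  using assms
proof (induction r arbitrary: t b)
  case Nil
  then have t: "t 0 = 4" and w: "reads (act (4, MRight) t) w"
    using reads_ConsD[of t 4 w] by simp_all
  have "tm_step (vc_tm M) (num_states M + (if b then 6 else 5), split_tape l [] # t # ts) =
      (num_states M + 5, split_tape ((if b then 2 else 1) # l) [] # act (4, MRight) t # ts)"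
    by (simp add: step_translate translate_def t act_right_split)
  from reaches_Suc[OF this reaches_refl] w show ?case by auto
next
  case (Cons x r)
  have t: "t 0 = x" "x \<noteq> 0" and w: "reads (act (x, MRight) t) (r @ 4 # w)"
    using reads_ConsD[of t x "r @ 4 # w"] Cons.prems(2) by simp_all
  have "tm_step (vc_tm M) (num_states M + (if b then 6 else 5), split_tape l [] # t # ts) =
      (num_states M + (if b \<or> x = 2 then 6 else 5), split_tape l [] # act (x, MRight) t # ts)"
    using t Cons.prems(1) act_stay[of "split_tape l []"]
    by (auto simp: step_translate translate_def)
  moreover obtain t' where "reads t' w" "reaches (vc_tm M) (Suc (length r))
      (num_states M + (if b \<or> x = 2 then 6 else 5), split_tape l [] # act (x, MRight) t # ts)
      (num_states M + 5,
        split_tape ((if (b \<or> x = 2) \<or> 2 \<in> set r then 2 else 1) # l) [] # t' # ts)"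
    using Cons.IH[OF _ w] Cons.prems(1) by fastforce
  ultimately have "reads t' w \<and> reaches (vc_tm M) (Suc (Suc (length r)))
      (num_states M + (if b then 6 else 5), split_tape l [] # t # ts)
      (num_states M + 5,
        split_tape ((if (b \<or> x = 2) \<or> 2 \<in> set r then 2 else 1) # l) [] # t' # ts)"
    using reaches_Suc by blast
  moreover have "(b \<or> x = 2) \<or> 2 \<in> set r \<longleftrightarrow> b \<or> 2 \<in> set (x # r)" by auto
  ultimately show ?case by (simp only: list.size add_Suc_right add_0_right) blast
qed

text \<open>One step per symbol suffices, as a mark is written in the same step that reads the
  separator.\<close>

lemma run_decode_rows:
  assumes "\<forall>r\<in>set rs. 4 \<notin> set r" and "reads t (enc_rows rs)"
  shows "\<exists>t'. reads t' [] \<and> reaches (vc_tm M) (length (enc_rows rs))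
     (num_states M + 5, split_tape l [] # t # ts)
     (num_states M + 5, split_tape (rev (map row_mark rs) @ l) [] # t' # ts)"
  using assms
proof (induction rs arbitrary: t l)
  case Nil
  then show ?case using reaches_refl by auto
next
  case (Cons r rs)
  have "4 \<notin> set r" "reads t (r @ 4 # enc_rows rs)" using Cons.prems by simp_all
  from run_decode_row[OF this, of M False l ts] obtain t1 where t1: "reads t1 (enc_rows rs)"
    "reaches (vc_tm M) (Suc (length r)) (num_states M + 5, split_tape l [] # t # ts)
       (num_states M + 5, split_tape (row_mark r # l) [] # t1 # ts)"
    by (auto simp: row_mark_def)
  from Cons.IH[OF _ t1(1), of "row_mark r # l"] Cons.prems(1) obtain t' where "reads t' []"
    "reaches (vc_tm M) (length (enc_rows rs))
       (num_states M + 5, split_tape (row_mark r # l) [] # t1 # ts)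
       (num_states M + 5, split_tape (rev (map row_mark rs) @ row_mark r # l) [] # t' # ts)"
    by auto
  with reaches_trans[OF t1(2) this(2)] show ?case by auto
qed

lemma run_decode:
  assumes "\<forall>r\<in>set rs. 4 \<notin> set r" and "reads t (enc_rows ([] # rs))"
  shows "\<exists>t'. reaches (vc_tm M) (length (enc_rows rs) + length rs + 3)
     (num_states M + 4, split_tape [] [] # t # ts)
     (num_states M + 8, split_tape [] (map row_mark rs) # t' # ts)"
proof -
  let ?l = "rev (map row_mark rs)"
  have t: "t 0 = 4" and w: "reads (act (4, MRight) t) (enc_rows rs)"
    using reads_ConsD[of t 4 "enc_rows rs"] assms(2) by simp_all
  \<comment> \<open>The separator of the empty apex row is skipped without writing a mark.\<close>
  have start: "tm_step (vc_tm M) (num_states M + 4, split_tape [] [] # t # ts) =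
      (num_states M + 5, split_tape [] [] # act (4, MRight) t # ts)"
    using t act_stay[of "split_tape [] []"] by (simp add: step_translate translate_def)
  obtain t' where t': "reads t' []" and run: "reaches (vc_tm M) (length (enc_rows rs))
      (num_states M + 5, split_tape [] [] # act (4, MRight) t # ts)
      (num_states M + 5, split_tape ?l [] # t' # ts)"
    using run_decode_rows[OF assms(1) w, of M "[]" ts] by auto
  have "tm_step (vc_tm M) (num_states M + 5, split_tape ?l [] # t' # ts) =
      (num_states M + 7, act (split_tape ?l [] 0, MLeft) (split_tape ?l []) # t' # ts)"
    using reads_NilD[OF t'] act_stay[of t'] by (simp add: step_translate translate_def)
  moreover have "0 \<notin> set ?l" by (auto simp: row_mark_def)
  ultimately have "reaches (vc_tm M) (Suc (Suc (length ?l)))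
      (num_states M + 5, split_tape ?l [] # t' # ts)
      (num_states M + 8, split_tape [] (rev ?l @ []) # t' # ts)"
    by (rule reaches_Suc[OF _ run_rewind_solution])
  from reaches_Suc[OF start reaches_trans[OF run this]] show ?thesis
    by (intro exI[of _ t']) (simp add: numeral_3_eq_3)
qed


section \<open>The approximation guarantee\<close>

lemma poly_nat_mono:
  fixes p :: "nat poly"
  assumes "x \<le> y"
  shows "poly p x \<le> poly p y"
  using assms by (induction p) (auto intro: mult_le_mono)

text \<open>The one-vertex graph is encoded by the separator 4 alone, so an alphabet that admits all
  instances contains 0 to 4.\<close>

lemma symbols_BTT_alg:
  assumes "poly_time_approx_alg \<alpha> BTT M"
  shows "5 \<le> num_symbols M"
proof -
  let ?G = "\<lparr>sverts = {..<1}, pos_edges = {}, neg_edges = {}\<rparr> :: nat signed_graph"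
  have "is_instance BTT ?G" by (auto simp: BTT_def signed_graph_wf_def)
  then have "set (enc_instance BTT ?G) \<subseteq> {..<num_symbols M}"
    using assms unfolding poly_time_approx_alg_def by blast
  moreover have "enc_instance BTT ?G = [4]"
    by (simp add: BTT_def enc_signed_graph_def enc_pairs_def)
  ultimately show ?thesis by simp
qed

lemma vc_tm_computes:
  assumes "tm_wf M" and "set (enc_instance BTT (apex_graph G)) \<subseteq> {..<num_symbols M}"
    and "computes_within M (enc_instance BTT (apex_graph G)) k
           (enc_solution BTT (apex_graph G) C)"
  shows "computes_within (vc_tm M) (enc_instance min_vertex_cover G)
           (7 * length (enc_instance min_vertex_cover G) + 7 + k)
           (enc_solution min_vertex_cover G (cover_of_transversal (card (verts G)) C))"
proof -
  let ?n = "card (verts G)"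
  define rs where "rs = pair_rows ?n (\<lambda>e. if e \<in> edges G then 2 else 1)"
  define ss where "ss = tl (pair_rows (Suc ?n) (\<lambda>e. if e \<in> C then 2 else 1))"
  define blanks where "blanks = replicate (num_tapes M - 1) blank_tape"
  let ?w = "enc_rows ([] # map apex_row rs)"
  have tapes: "num_tapes M = Suc (num_tapes M - 1)" using assms(1) by (simp add: tm_wf_def)
  have rs: "\<forall>r\<in>set rs. set r \<subseteq> {1, 2}" by (auto simp: rs_def pair_rows_def)
  have ss: "\<forall>r\<in>set ss. 4 \<notin> set r" by (auto simp: ss_def pair_rows_Suc simp del: upt_Suc)
  have len: "length rs = ?n" "length ss = ?n" "length (enc_rows ss) = length (enc_rows rs) + ?n"
    unfolding rs_def ss_def by (rule length_enc_tl_pair_rows | simp)+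
  have "?n \<le> length (enc_rows rs)" using length_le_enc_rows[of rs] len(1) by simp
  have sol: "enc_solution BTT (apex_graph G) C = enc_rows ([] # ss)"
    by (simp add: BTT_def enc_edge_set_def enc_pairs_eq_enc_rows pair_rows_Suc apex_graph_def ss_def)
  have w: "enc_instance BTT (apex_graph G) = ?w" unfolding rs_def by (rule enc_apex_graph)
  have initM: "init_config M ?w = (0, split_tape [] ?w # blanks)"
    by (simp add: init_config_def input_tape_split blanks_def)
  obtain ts where run: "(tm_step M ^^ k) (init_config M ?w) = (num_states M, ts)"
    and out: "reads (hd ts) (enc_rows ([] # ss))"
    using assms(3) unfolding computes_within_def w sol by blast
  \<comment> \<open>This ensures that a first tape exists, so that \<open>hd ts\<close> is an actual
    tape.\<close>
  have "over_alphabet M ts"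
    using over_alphabet_funpow[OF assms(1) over_alphabet_init[OF assms(1,2)], of k] run w by simp
  then have "ts \<noteq> []" using tapes by (auto simp: over_alphabet_def)
  then obtain t ts' where ts: "ts = t # ts'" by (cases ts) auto
  have init: "init_config (vc_tm M) (enc_rows rs) =
      (0, split_tape [] (enc_rows rs) # split_tape [] [] # blanks)"
    unfolding init_config_def vc_tm_simps blanks_def diff_Suc_1
    by (subst tapes) (simp add: input_tape_split blank_tape_split)
  have enc: "reaches (vc_tm M) (2 * length (enc_rows rs) + 2 * length rs + 4)
      (init_config (vc_tm M) (enc_rows rs)) (4, split_tape [] [] # split_tape [] ?w # blanks)"
    unfolding init using rs by (rule run_encode)
  have sim: "reaches (vc_tm M) k (4, split_tape [] [] # split_tape [] ?w # blanks)
      (num_states M + 4, split_tape [] [] # t # ts')"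
    using run_simulate[OF run[unfolded initM], of "split_tape [] []"] ts by simp
  obtain t' where dec: "reaches (vc_tm M) (length (enc_rows ss) + length ss + 3)
      (num_states M + 4, split_tape [] [] # t # ts')
      (num_states M + 8, split_tape [] (map row_mark ss) # t' # ts')"
    using run_decode[OF ss, of t M ts'] out ts by auto
  have out': "enc_solution min_vertex_cover G (cover_of_transversal ?n C) = map row_mark ss"
    by (simp add: row_mark_transversal min_vertex_cover_def ss_def)
  show ?thesis
    unfolding enc_instance_min_vertex_cover rs_def[symmetric] out'
  proof (rule computes_withinI)
    show "reaches (vc_tm M)
        (2 * length (enc_rows rs) + 2 * length rs + 4 +
          (k + (length (enc_rows ss) + length ss + 3)))
        (init_config (vc_tm M) (enc_rows rs))
        (num_states (vc_tm M), split_tape [] (map row_mark ss) # t' # ts')"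
      using reaches_trans[OF enc reaches_trans[OF sim dec]] by simp
    \<comment> \<open>With \<open>N\<close> the input length and \<open>n\<close> the number of
      vertices, the left side is \<open>3 * N + 4 * n + 7 + k\<close>, and \<open>n\<close> is at
      most \<open>N\<close>.\<close>
    show "2 * length (enc_rows rs) + 2 * length rs + 4 +
          (k + (length (enc_rows ss) + length ss + 3))
        \<le> 7 * length (enc_rows rs) + 7 + k"
      using len \<open>?n \<le> length (enc_rows rs)\<close> by simp
    show "reads (hd (split_tape [] (map row_mark ss) # t' # ts')) (map row_mark ss)"
      unfolding list.sel by (rule reads_split_tape) (auto simp: row_mark_def)
  qed
qed

theorem theorem4:
  fixes \<alpha> :: real
  assumes "\<alpha> \<ge> 1"
    and "\<exists>M. poly_time_approx_alg \<alpha> BTT M"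
  shows "\<exists>M. poly_time_approx_alg \<alpha> min_vertex_cover M"
proof -
  obtain M where M: "poly_time_approx_alg \<alpha> BTT M" using assms(2) by blast
  then have wf: "tm_wf M" by (simp add: poly_time_approx_alg_def)
  obtain p where p: "\<And>H. is_instance BTT H \<Longrightarrow>
      set (enc_instance BTT H) \<subseteq> {..<num_symbols M} \<and>
      (\<exists>C. feasible BTT H C \<and> real (cost BTT H C) \<le> \<alpha> * real (opt BTT H) \<and>
        computes_within M (enc_instance BTT H) (poly p (length (enc_instance BTT H)))
          (enc_solution BTT H C))"
    using M unfolding poly_time_approx_alg_def by blast
  \<comment> \<open>The apex instance has length at most \<open>1 + 2 * N\<close> for input length
    \<open>N\<close>, hence the composition; \<open>7 + 7 * N\<close> pays for both
    translations.\<close>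
  define q :: "nat poly" where "q = [:7, 7:] + pcompose p [:1, 2:]"
  have "set (enc_instance min_vertex_cover G) \<subseteq> {..<num_symbols (vc_tm M)}" for G
    using symbols_BTT_alg[OF M]
    by (auto simp: min_vertex_cover_def enc_graph_def enc_edge_set_def enc_pairs_def)
  moreover have "\<exists>S. feasible min_vertex_cover G S \<and>
      real (cost min_vertex_cover G S) \<le> \<alpha> * real (opt min_vertex_cover G) \<and>
      computes_within (vc_tm M) (enc_instance min_vertex_cover G)
        (poly q (length (enc_instance min_vertex_cover G))) (enc_solution min_vertex_cover G S)"
    if G: "is_instance min_vertex_cover G" for G
  proof -
    let ?w = "enc_instance min_vertex_cover G"
    let ?w' = "enc_instance BTT (apex_graph G)"
    have alphabet: "set ?w' \<subseteq> {..<num_symbols M}"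
      using p[OF is_instance_apex_graph[OF G]] by blast
    obtain C where C: "feasible BTT (apex_graph G) C"
      "real (cost BTT (apex_graph G) C) \<le> \<alpha> * real (opt BTT (apex_graph G))"
      "computes_within M ?w' (poly p (length ?w')) (enc_solution BTT (apex_graph G) C)"
      using p[OF is_instance_apex_graph[OF G]] by blast
    let ?S = "cover_of_transversal (card (verts G)) C"
    have "cost min_vertex_cover G ?S \<le> cost BTT (apex_graph G) C"
      using card_cover_of_transversal_le[OF finite_transversal[OF G C(1)]]
      by (simp add: min_vertex_cover_def BTT_def)
    also note C(2)
    also have "\<alpha> * real (opt BTT (apex_graph G)) \<le> \<alpha> * real (opt min_vertex_cover G)"
      using opt_apex_graph_le[OF G] assms(1) by (intro mult_left_mono) auto
    finally have "real (cost min_vertex_cover G ?S) \<le> \<alpha> * real (opt min_vertex_cover G)" by simp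
    moreover have "length ?w' \<le> 1 + 2 * length ?w"
      using length_le_enc_rows[of "pair_rows (card (verts G)) (\<lambda>e. if e \<in> edges G then 2 else 1)"]
      by (simp add: enc_apex_graph enc_instance_min_vertex_cover length_enc_rows_apex)
    then have "7 * length ?w + 7 + poly p (length ?w') \<le> poly q (length ?w)"
      using poly_nat_mono[of "length ?w'" "1 + 2 * length ?w" p]
      by (simp add: q_def poly_pcompose mult.commute)
    then have "computes_within (vc_tm M) ?w (poly q (length ?w))
        (enc_solution min_vertex_cover G ?S)"
      using computes_within_mono[OF vc_tm_computes[OF wf alphabet C(3)]] by blast
    ultimately show ?thesis using feasible_cover_of_transversal[OF G C(1)] by blast
  qed
  ultimately have "poly_time_approx_alg \<alpha> min_vertex_cover (vc_tm M)"
    using tm_wf_vc_tm[OF wf symbols_BTT_alg[OF M]] unfolding poly_time_approx_alg_def by blast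
  then show ?thesis by blast
qed

end
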